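(* Let $k,r$ be integers with $k\ge 2r+1$ and $r\ge1$, and let $\phi=\phi_{k,r}$ be the substitution on $\{1,\dots,k\}$ defined in the context. (a) If $\phi$ is primitive, then $\phi$, acting on $\{1,\dots,k\}^{\mathbb N}$, has a unique fixed point and no other periodic points. (b) For all $n>k$, $$\phi^n(1)=\phi^{n-1}(1)\,\phi^{n-2}(1)\cdots\phi^{n-k+r+1}(1)\,\phi^{n-k}(r+1),$$ $$\phi^n(r+1)=\phi^{n-1}(1)\,\phi^{n-2}(1)\cdots\phi^{n-k+2r+1}(1)\,\phi^{n-k+r}(r+1).$$ Moreover, for $n>k$ it is not possible to express $\phi^n(1)$ as a juxtaposition (concatenation) of words all of the form $\phi^j(1)$ with $0\le j\le n-1$. (c) The characteristic polynomial of the substitution matrix $M_{\phi_{k,r}}$ is $p_{k,r}(x)$. (d) The sequence $\{|\phi_{k,r}^n(1)|\}_{n\ge0}$ is the $(k,r)$-Lorenz-Fibonacci sequence of the second kind, i.e. $\ell_{k,r}(n)=|\phi_{k,r}^n(1)|$ for all $n\ge0$.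
   Context: Words and substitutions. Let $\mathcal A=\{1,\dots,k\}$, let $\mathcal A^*$ be the set of finite words over $\mathcal A$, and let $|U|$ denote the length of a word $U$. A substitution is a map $\phi:\mathcal A\to\mathcal A^*$, extended to $\mathcal A^*$ by concatenation, $\phi(UV)=\phi(U)\phi(V)$, and to one-sided infinite sequences by $\phi(v_1v_2\cdots)=\phi(v_1)\phi(v_2)\cdots$; $\phi^n$ is the $n$-th iterate and $\phi^0$ is the identity. A fixed point is $\mathbf v\in\mathcal A^{\mathbb N}$ with $\phi(\mathbf v)=\mathbf v$; a periodic point is $\mathbf v\in\mathcal A^{\mathbb N}$ with $\phi^m(\mathbf v)=\mathbf v$ for some $m\ge1$. The substitution $\phi_{k,r}$ is defined on $\{1,\dots,k\}$ as follows, where juxtaposition of symbols denotes a word: $j\mapsto 1\,(j+1)$ (a word of length 2) for $1\le j\le k-r-1$; $j\mapsto (j+1)$ (a word of length 1) for $k-r\le j\le k-1$; $k\mapsto (r+1)$ (a word of length 1). The matrix $M_\phi$ is the $k\times k$ matrix whose $(i,j)$ entry is the number of occurrences of the symbol $i$ in the word $\phi(j)$. The substitution $\phi$ is primitive if some power $M_\phi^m$, $m>0$, has all entries positive. In (b), the product $\phi^{n-1}(1)\cdots\phi^{n-k+r+1}(1)$ has the $k-r-1$ factors with exponents decreasing by one from $n-1$ to $n-k+r+1$, and $\phi^{n-1}(1)\cdots\phi^{n-k+2r+1}(1)$ has the $k-2r-1$ factors with exponents decreasing by one from $n-1$ to $n-k+2r+1$ (it is the empty word if $k=2r+1$). The polynomial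 is $p_{k,r}(x)=x^k-x^{k-1}-\cdots-x^r+x^{r-1}+\cdots+x+1$, i.e. $p_{k,r}(x)=x^k-\sum_{i=r}^{k-1}x^i+\sum_{i=0}^{r-1}x^i$. The $(k,r)$-Lorenz-Fibonacci sequence of the second kind $\{\ell_{k,r}(n)\}_{n\ge0}$ is defined by the initial values $\ell_{k,r}(n)=2^n$ for $0\le n\le k-r-1$ and $\ell_{k,r}(n)=2^n-(n-k+r+1)2^{n-k+r}$ for $k-r\le n\le k-1$, together with the recurrence, for $n\ge0$, $\ell_{k,r}(n+k)=\sum_{j=r}^{k-1}\ell_{k,r}(n+j)-\sum_{j=0}^{r-1}\ell_{k,r}(n+j)$. *)

theory Defs
  imports
    "HOL-Library.Stream"
    "Jordan_Normal_Form.Char_Poly"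
begin

text \<open>
  Substitutions over the alphabet \<open>{1..k}\<close> are maps \<^typ>\<open>nat \<Rightarrow> nat list\<close>, of which only the
  values on \<open>{1..k}\<close> matter. One-sided infinite sequences over the alphabet are the elements of
  \<open>streams {1..k}\<close>.
\<close>

definition subst_word :: "('a \<Rightarrow> 'a list) \<Rightarrow> 'a list \<Rightarrow> 'a list" where
  "subst_word \<phi> w = concat (map \<phi> w)"

definition subst_iter :: "('a \<Rightarrow> 'a list) \<Rightarrow> nat \<Rightarrow> 'a \<Rightarrow> 'a list" where
  "subst_iter \<phi> n a = (subst_word \<phi> ^^ n) [a]"

text \<open>
  \<^const>\<open>flat\<close> is the infinite concatenation of a stream of words provided that all these words are
  nonempty, so the next definition is meant for substitutions without empty images.
\<close>

definition subst_stream :: "('a \<Rightarrow> 'a list) \<Rightarrow> 'a stream \<Rightarrow> 'a stream" where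
  "subst_stream \<phi> v = flat (smap \<phi> v)"

definition fixed_points :: "'a set \<Rightarrow> ('a \<Rightarrow> 'a list) \<Rightarrow> 'a stream set" where
  "fixed_points A \<phi> = {v \<in> streams A. subst_stream \<phi> v = v}"

definition periodic_points :: "'a set \<Rightarrow> ('a \<Rightarrow> 'a list) \<Rightarrow> 'a stream set" where
  "periodic_points A \<phi> = {v \<in> streams A. \<exists>m\<ge>1. (subst_stream \<phi> ^^ m) v = v}"

text \<open>Matrix indices start at 0, symbols at 1.\<close>

definition subst_matrix :: "nat \<Rightarrow> (nat \<Rightarrow> nat list) \<Rightarrow> int mat" where
  "subst_matrix k \<phi> = mat k k (\<lambda>(i, j). int (count_list (\<phi> (j + 1)) (i + 1)))"

definition primitive_subst :: "nat \<Rightarrow> (nat \<Rightarrow> nat list) \<Rightarrow> bool" where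
  "primitive_subst k \<phi> \<longleftrightarrow>
     (\<exists>m>0. \<forall>i<k. \<forall>j<k. (subst_matrix k \<phi> ^\<^sub>m m) $$ (i, j) > 0)"

text \<open>Meant for \<open>1 \<le> r\<close> and \<open>2 * r + 1 \<le> k\<close>; outside \<open>{1..k}\<close> the value is immaterial.\<close>

definition lf_subst :: "nat \<Rightarrow> nat \<Rightarrow> nat \<Rightarrow> nat list" where
  "lf_subst k r j =
     (if j \<le> k - r - 1 then [1, j + 1]
      else if j \<le> k - 1 then [j + 1]
      else [r + 1])"

definition lf_poly :: "nat \<Rightarrow> nat \<Rightarrow> int poly" where
  "lf_poly k r = monom 1 k - (\<Sum>i=r..<k. monom 1 i) + (\<Sum>i<r. monom 1 i)"

text \<open>
  The initial values and the recurrence are shifted so that no subtraction of naturals truncates.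
  The test \<open>r \<le> k\<close> only serves termination; the two lemmas below give the usual form.
\<close>

function lorenz_fib :: "nat \<Rightarrow> nat \<Rightarrow> nat \<Rightarrow> int" where
  "lorenz_fib k r n =
     (if n < k then
        (if n + r < k then 2 ^ n
         else 2 ^ n - int (n + r + 1 - k) * 2 ^ (n + r - k))
      else if r \<le> k then
        (\<Sum>j=r..<k. lorenz_fib k r (n - k + j)) - (\<Sum>j<r. lorenz_fib k r (n - k + j))
      else 0)"
  by pat_completeness auto
termination
  by (relation "measure (\<lambda>(k, r, n). n)") auto

declare lorenz_fib.simps [simp del]

lemma lorenz_fib_initial:
  assumes "r + 1 \<le> k"
  shows "n \<le> k - r - 1 \<Longrightarrow> lorenz_fib k r n = 2 ^ n"
    and "k - r \<le> n \<Longrightarrow> n \<le> k - 1 \<Longrightarrow>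
      lorenz_fib k r n = 2 ^ n - (int n - int k + int r + 1) * 2 ^ (n - (k - r))"
proof -
  show "n \<le> k - r - 1 \<Longrightarrow> lorenz_fib k r n = 2 ^ n"
    using assms by (subst lorenz_fib.simps) auto
next
  assume n: "k - r \<le> n" "n \<le> k - 1"
  have "int (n + r + 1 - k) = int n - int k + int r + 1" and "n + r - k = n - (k - r)"
    using n assms by auto
  then show "lorenz_fib k r n = 2 ^ n - (int n - int k + int r + 1) * 2 ^ (n - (k - r))"
    using n assms by (subst lorenz_fib.simps) auto
qed

lemma lorenz_fib_recurrence:
  assumes "r \<le> k"
  shows "lorenz_fib k r (n + k) =
    (\<Sum>j=r..<k. lorenz_fib k r (n + j)) - (\<Sum>j<r. lorenz_fib k r (n + j))"
  using assms by (subst lorenz_fib.simps) auto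

end

theory Submission
  imports Defs "HOL-Library.Sublist"
begin

text \<open>
  Iterating \<open>\<phi>(j) = 1 (j + 1)\<close> for \<open>j < k - r\<close> splits off one word \<open>\<phi>\<^sup>i(1)\<close> per step, and the
  remaining letter runs from \<open>k - r\<close> back to \<open>r + 1\<close> in \<open>r + 1\<close> steps without growing. This gives
  the decompositions and, taking lengths, the recurrence.

  If \<open>\<phi>\<^sup>n(1)\<close> were a concatenation of earlier iterates, some \<open>\<phi>\<^sup>j(1)\<close> with \<open>j < n\<close> would be a suffix
  of it. Since \<open>\<phi>\<close> can be decoded uniquely from the right, this descends to \<open>1\<close> being a suffix of
  \<open>\<phi>\<^sup>n\<^sup>-\<^sup>j(1)\<close>, but no image ends with \<open>1\<close>.

  For \<open>k = 2r + 1\<close> the letters \<open>r + 1, \<dots>, k\<close> are permuted among themselves, so \<open>\<phi>\<close> is not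
  primitive. For \<open>k > 2r + 1\<close> the first letter of every iterate eventually becomes \<open>1\<close>, so a
  periodic point starts with \<open>1\<close>, hence with every \<open>\<phi>\<^sup>m\<^sup>t(1)\<close>, \<open>m\<close> being a period.
\<close>

section \<open>Substitutions acting on words and on streams\<close>

lemma subst_word_Nil [simp]: "subst_word \<phi> [] = []"
  by (simp add: subst_word_def)

lemma subst_word_Cons [simp]: "subst_word \<phi> (a # w) = \<phi> a @ subst_word \<phi> w"
  by (simp add: subst_word_def)

lemma subst_word_append [simp]: "subst_word \<phi> (u @ v) = subst_word \<phi> u @ subst_word \<phi> v"
  by (simp add: subst_word_def)

lemma subst_iter_0 [simp]: "subst_iter \<phi> 0 a = [a]"
  by (simp add: subst_iter_def)

lemma funpow_subst_word_append:
  "(subst_word \<phi> ^^ n) (u @ v) = (subst_word \<phi> ^^ n) u @ (subst_word \<phi> ^^ n) v"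
  by (induction n) auto

lemma funpow_subst_word: "(subst_word \<phi> ^^ n) w = concat (map (subst_iter \<phi> n) w)"
proof (induction w)
  case Nil
  show ?case by (induction n) auto
next
  case (Cons a w)
  then show ?case
    using funpow_subst_word_append[where n = n and u = "[a]" and v = w] by (simp add: subst_iter_def)
qed

lemma subst_iter_Suc: "subst_iter \<phi> (Suc n) a = subst_word \<phi> (subst_iter \<phi> n a)"
  by (simp add: subst_iter_def)

lemma subst_iter_Suc_right: "subst_iter \<phi> (Suc n) a = concat (map (subst_iter \<phi> n) (\<phi> a))"
  by (simp add: subst_iter_def funpow_Suc_right funpow_subst_word del: funpow.simps)

lemma set_subst_iter:
  assumes "\<And>a. a \<in> A \<Longrightarrow> set (\<phi> a) \<subseteq> A" and "a \<in> A"
  shows "set (subst_iter \<phi> n a) \<subseteq> A"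
  using assms by (induction n) (force simp: subst_iter_Suc subst_word_def)+

lemma subst_stream_shift:
  assumes "\<And>a. \<phi> a \<noteq> []"
  shows "subst_stream \<phi> (w @- v) = subst_word \<phi> w @- subst_stream \<phi> v"
  using assms by (induction w) (auto simp: subst_stream_def)

lemma funpow_subst_stream_shift:
  assumes "\<And>a. \<phi> a \<noteq> []"
  shows "(subst_stream \<phi> ^^ n) (w @- v) = (subst_word \<phi> ^^ n) w @- (subst_stream \<phi> ^^ n) v"
  by (induction n) (auto simp: subst_stream_shift assms)

lemma shd_subst_stream: "shd (subst_stream \<phi> v) = hd (\<phi> (shd v))"
  by (simp add: subst_stream_def)

lemma shd_funpow_subst_stream:
  "shd ((subst_stream \<phi> ^^ n) v) = ((\<lambda>a. hd (\<phi> a)) ^^ n) (shd v)"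
  by (induction n) (auto simp: shd_subst_stream)

section \<open>Periodic streams and limits of prefix chains\<close>

lemma funpow_mult_fixed:
  assumes "(f ^^ m) x = x"
  shows "(f ^^ (m * n)) x = x"
  by (induction n) (auto simp: funpow_add assms)

lemma stream_eqI_stake:
  assumes "\<And>n. \<exists>m\<ge>n. stake m u = stake m v"
  shows "u = v"
proof -
  have "u !! n = v !! n" for n
  proof -
    obtain m where "m \<ge> Suc n" "stake m u = stake m v" using assms by blast
    then show ?thesis by (metis Suc_le_lessD stake_nth)
  qed
  then show ?thesis using smap_alt[of id u v] by (simp add: stream.map_id)
qed

text \<open>The limit is read off the diagonal: \<open>p n\<close> is long enough to have an entry
  at position \<open>n\<close>, and any two words of the chain are comparable, so they agree
  wherever both are defined.\<close>

lemma stream_of_prefix_chain: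
  assumes prefix: "\<And>n. prefix (p n) (p (Suc n))" and length: "\<And>n. length (p n) > n"
  obtains v where "\<And>n. stake (length (p n)) v = p n" and "\<And>n. v !! n = p n ! n"
proof
  define v where "v = smap (\<lambda>n. p n ! n) nats"
  show nth: "v !! n = p n ! n" for n by (simp add: v_def)
  have mono: "prefix (p m) (p n)" if "m \<le> n" for m n
    using that by (induction rule: dec_induct) (auto intro: prefix prefix_order.trans)
  show "stake (length (p n)) v = p n" for n
  proof (rule nth_equalityI)
    fix i assume i: "i < length (stake (length (p n)) v)"
    have "prefix (p i) (p n) \<or> prefix (p n) (p i)" using mono by (meson nat_le_linear)
    then have "p i ! i = p n ! i" using i length[of i] by (auto simp: prefix_def nth_append)
    then show "stake (length (p n)) v ! i = p n ! i" using i nth by simp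
  qed simp
qed

lemma periodic_stream_unique:
  assumes nonempty: "\<And>a. \<phi> a \<noteq> []" and growth: "\<And>n. length (subst_iter \<phi> n a) > n"
    and u: "shd u = a" "(subst_stream \<phi> ^^ m) u = u" "m \<ge> 1"
    and v: "shd v = a" "(subst_stream \<phi> ^^ n) v = v" "n \<ge> 1"
  shows "u = v"
proof (rule stream_eqI_stake)
  fix t
  \<comment> \<open>A common multiple of both periods that is at least \<open>t\<close>. Both
    streams begin with \<open>a\<close> and are fixed by the \<open>?N\<close>-th iterate, so both
    begin with the image of \<open>a\<close> under it.\<close>
  let ?N = "m * n * t"
  let ?p = "subst_iter \<phi> ?N a"
  have *: "stake (length ?p) w = ?p" if "shd w = a" "(subst_stream \<phi> ^^ ?N) w = w" for w
  proof -
    have "w = [a] @- stl w" using that(1) stream.collapse[of w] by simp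
    then have "w = ?p @- (subst_stream \<phi> ^^ ?N) (stl w)"
      using that(2) funpow_subst_stream_shift[OF nonempty, where n = ?N and w = "[a]" and v = "stl w"]
      by (simp add: subst_iter_def)
    then show ?thesis by (metis append_Nil2 diff_self_eq_0 stake.simps(1) stake_shift take_all_iff order_refl)
  qed
  have "t \<le> ?N" using u(3) v(3) by simp
  then have "t \<le> length ?p" using growth[of ?N] by linarith
  moreover have "(subst_stream \<phi> ^^ ?N) u = u"
    using funpow_mult_fixed[OF u(2), of "n * t"] by (simp add: mult.assoc)
  moreover have "(subst_stream \<phi> ^^ ?N) v = v"
    using funpow_mult_fixed[OF v(2), of "m * t"] by (simp add: ac_simps)
  ultimately show "\<exists>l\<ge>t. stake l u = stake l v"
    using *[of u] *[of v] u(1) v(1) by (intro exI[of _ "length ?p"]) simp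
qed

text \<open>The limit \<open>v\<close> of the iterates on \<open>a\<close> is fixed: its prefix
  \<open>subst_iter \<phi> n a\<close> is mapped to the next iterate, which is again a prefix of
  \<open>v\<close>.\<close>

lemma fixed_stream_exists:
  assumes nonempty: "\<And>a. \<phi> a \<noteq> []" and growth: "\<And>n. length (subst_iter \<phi> n a) > n"
    and prefix: "\<And>n. prefix (subst_iter \<phi> n a) (subst_iter \<phi> (Suc n) a)"
    and closed: "\<And>b. b \<in> A \<Longrightarrow> set (\<phi> b) \<subseteq> A" and a: "a \<in> A"
  obtains v where "v \<in> fixed_points A \<phi>" "shd v = a"
proof -
  obtain v where v: "\<And>n. stake (length (subst_iter \<phi> n a)) v = subst_iter \<phi> n a"
      and nth: "\<And>n. v !! n = subst_iter \<phi> n a ! n"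
    using stream_of_prefix_chain[of "\<lambda>n. subst_iter \<phi> n a", OF prefix growth] by blast
  have "subst_stream \<phi> v = v"
  proof (rule stream_eqI_stake)
    fix n
    let ?l = "length (subst_iter \<phi> (Suc n) a)"
    have "v = subst_iter \<phi> n a @- sdrop (length (subst_iter \<phi> n a)) v"
      by (metis v stake_sdrop)
    then have "subst_stream \<phi> v
        = subst_iter \<phi> (Suc n) a @- subst_stream \<phi> (sdrop (length (subst_iter \<phi> n a)) v)"
      by (metis subst_iter_Suc subst_stream_shift nonempty)
    then have "stake ?l (subst_stream \<phi> v) = stake ?l v"
      by (simp add: stake_shift v)
    then show "\<exists>m\<ge>n. stake m (subst_stream \<phi> v) = stake m v"
      using growth[of "Suc n"] by (intro exI[of _ ?l]) simp
  qed
  moreover have "v \<in> streams A"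
    unfolding streams_iff_snth nth
    using set_subst_iter[of A \<phi> a, OF closed a] growth by (meson nth_mem subsetD)
  moreover have "shd v = a" using nth[of 0] by simp
  ultimately show ?thesis using that by (auto simp: fixed_points_def)
qed

lemma fixed_points_subset_periodic_points: "fixed_points A \<phi> \<subseteq> periodic_points A \<phi>"
  by (auto simp: fixed_points_def periodic_points_def intro!: exI[of _ 1])

section \<open>Determinants of Hessenberg matrices\<close>

text \<open>Replacing row 0 by the combination of all rows with coefficients \<open>f\<close> leaves a single nonzero
  entry in that row, whose minor is triangular with diagonal entries \<open>-1\<close>.\<close>

lemma det_hessenberg:
  fixes A :: "'a :: comm_ring_1 mat"
  assumes A: "A \<in> carrier_mat (Suc n) (Suc n)"
    and hess: "\<And>i j. Suc j < i \<Longrightarrow> i \<le> n \<Longrightarrow> A $$ (i, j) = 0"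
    and sub: "\<And>j. j < n \<Longrightarrow> A $$ (Suc j, j) = -1"
    and f0: "f 0 = 1"
    and f: "\<And>j. j < n \<Longrightarrow> (\<Sum>i\<le>n. f i * A $$ (i, j)) = 0"
  shows "det A = (\<Sum>i\<le>n. f i * A $$ (i, n))"
proof -
  define P where "P = mat (Suc n) (Suc n) (\<lambda>(i, j). if i = 0 then f j else if i = j then 1 else 0)"
  define B where "B = P * A"
  define C where "C = mat_delete B 0 n"
  have P: "P \<in> carrier_mat (Suc n) (Suc n)" by (simp add: P_def)
  have B: "B \<in> carrier_mat (Suc n) (Suc n)" using P A by (simp add: B_def)
  have "det P = prod_list (diag_mat P)"
    by (rule det_upper_triangular[OF _ P]) (auto simp: P_def upper_triangular_def)
  also have "diag_mat P = map (\<lambda>i. 1) [0..<Suc n]"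
    unfolding diag_mat_def by (rule map_cong) (auto simp: P_def f0)
  finally have "det P = 1" by (simp add: map_replicate_const)
  then have "det A = det B" using det_mult[OF P A] by (simp add: B_def)
  have entry: "B $$ (i, j) = (\<Sum>l\<le>n. P $$ (i, l) * A $$ (l, j))" if "i \<le> n" "j \<le> n" for i j
    using that P A by (auto simp: B_def scalar_prod_def atLeast0LessThan lessThan_Suc_atMost intro: sum.cong)
  have B0: "B $$ (0, j) = (\<Sum>i\<le>n. f i * A $$ (i, j))" if "j \<le> n" for j
    using entry[of 0 j] that by (simp add: P_def)
  have BS: "B $$ (i, j) = A $$ (i, j)" if "0 < i" "i \<le> n" "j \<le> n" for i j
  proof -
    have "B $$ (i, j) = (\<Sum>l\<le>n. if l = i then A $$ (l, j) else 0)"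
      unfolding entry[OF that(2,3)] using that by (intro sum.cong) (auto simp: P_def)
    then show ?thesis using that by simp
  qed
  have C: "C \<in> carrier_mat n n" using B by (simp add: C_def mat_delete_def)
  have entryC: "C $$ (i, j) = A $$ (Suc i, j)" if "i < n" "j < n" for i j
    using that B BS[of "Suc i" j] by (simp add: C_def mat_delete_def)
  have "det C = prod_list (diag_mat C)"
    using C by (intro det_upper_triangular[OF _ C]) (auto simp: upper_triangular_def entryC hess)
  also have "diag_mat C = map (\<lambda>i. -1) [0..<n]"
    unfolding diag_mat_def using C by (intro map_cong) (auto simp: entryC sub)
  finally have "det C = (-1) ^ n" by (simp add: map_replicate_const)
  then have cof: "cofactor B 0 n = 1" by (simp add: cofactor_def C_def flip: power_add mult_2)
  have "det B = (\<Sum>j<Suc n. B $$ (0, j) * cofactor B 0 j)"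
    by (rule laplace_expansion_row[OF B]) simp
  also have "\<dots> = B $$ (0, n)" using B0 f by (simp add: cof)
  finally show ?thesis using B0[of n] \<open>det A = det B\<close> by simp
qed

section \<open>The Lorenz-Fibonacci substitution\<close>

text \<open>Converts the additive exponents suited to induction into the descending exponents
  \<open>n - t\<close> of the decompositions.\<close>

lemma map_diff_upt_eq_map_add_rev:
  assumes "i \<le> n"
  shows "map (\<lambda>t. g (n - t)) [1..<Suc i] = map (\<lambda>t. g (n - i + t)) (rev [0..<i])"
  using assms by (intro nth_equalityI) (auto simp: rev_nth simp del: upt_Suc intro: arg_cong[of _ _ g])

locale lorenz_fib_substitution =
  fixes k r :: nat
  assumes k: "2 * r + 1 \<le> k" and r: "1 \<le> r"
begin

abbreviation \<phi> :: "nat \<Rightarrow> nat list" where "\<phi> \<equiv> lf_subst k r"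

text \<open>With \<open>Suc 0\<close>, the simp normal form of \<open>1\<close>, equations about \<open>W\<close> work as rewrite rules.\<close>

abbreviation W :: "nat \<Rightarrow> nat list" where "W n \<equiv> subst_iter \<phi> n (Suc 0)"

lemma subst_last: "\<phi> k = [r + 1]"
proof -
  have "\<not> k \<le> k - r - 1" "\<not> k \<le> k - 1" using k by auto
  then show ?thesis unfolding lf_subst_def by simp
qed

lemma subst_low: "j < k - r \<Longrightarrow> \<phi> j = [1, j + 1]"
  by (simp add: lf_subst_def)

lemma subst_nonempty [simp]: "\<phi> a \<noteq> []"
  by (simp add: lf_subst_def)

lemma subst_word_eq_Nil_iff [simp]: "subst_word \<phi> w = [] \<longleftrightarrow> w = []"
  by (cases w) auto

lemma set_subst: "a \<in> {1..k} \<Longrightarrow> set (\<phi> a) \<subseteq> {1..k}"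
  using k r by (auto simp: lf_subst_def)

lemma set_subst_iter_subset: "a \<in> {1..k} \<Longrightarrow> set (subst_iter \<phi> n a) \<subseteq> {1..k}"
  by (rule set_subst_iter) (rule set_subst)

lemma subst_iter_nonempty [simp]: "subst_iter \<phi> n a \<noteq> []"
  by (induction n) (auto simp: subst_iter_Suc)

lemma subst_iter_Suc_low:
  "j < k - r \<Longrightarrow> subst_iter \<phi> (Suc n) j = W n @ subst_iter \<phi> n (Suc j)"
  by (auto simp: subst_iter_Suc_right lf_subst_def)

lemma subst_iter_Suc_high:
  "k - r \<le> j \<Longrightarrow> j < k \<Longrightarrow> subst_iter \<phi> (Suc n) j = subst_iter \<phi> n (Suc j)"
  using k r by (auto simp: subst_iter_Suc_right lf_subst_def)

lemma subst_iter_Suc_last: "subst_iter \<phi> (Suc n) k = subst_iter \<phi> n (r + 1)"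
  using k r by (auto simp: subst_iter_Suc_right lf_subst_def)

lemma W_Suc: "W (Suc n) = W n @ subst_iter \<phi> n 2"
  using subst_iter_Suc_low[of 1 n] k r by (simp add: numeral_2_eq_2)

lemma length_W: "length (W n) > n"
proof (induction n)
  case (Suc n)
  moreover have "length (subst_iter \<phi> n 2) > 0" by simp
  ultimately show ?case unfolding W_Suc length_append by linarith
qed simp

lemma hd_W: "hd (W n) = 1"
  by (induction n) (auto simp: W_Suc)

section \<open>Decompositions of the iterates\<close>

lemma subst_iter_add_low:
  "j + i \<le> k - r \<Longrightarrow>
    subst_iter \<phi> (n + i) j = concat (map (\<lambda>t. W (n + t)) (rev [0..<i])) @ subst_iter \<phi> n (j + i)"
proof (induction i arbitrary: j)
  case (Suc i)
  then show ?case using subst_iter_Suc_low[of j "n + i"] by simp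
qed simp

lemma subst_iter_low:
  assumes "i \<le> n" and "j + i \<le> k - r"
  shows "subst_iter \<phi> n j = concat (map (\<lambda>t. W (n - t)) [1..<Suc i]) @ subst_iter \<phi> (n - i) (j + i)"
  using subst_iter_add_low[OF assms(2), of "n - i"] map_diff_upt_eq_map_add_rev[OF assms(1), of W] assms
  by simp

lemma subst_iter_add_high:
  "j + i \<le> k \<Longrightarrow> k - r \<le> j \<Longrightarrow> subst_iter \<phi> (n + i) j = subst_iter \<phi> n (j + i)"
proof (induction i arbitrary: j)
  case (Suc i)
  then show ?case using subst_iter_Suc_high[of j "n + i"] by simp
qed simp

lemma subst_iter_wrap: "subst_iter \<phi> (n + Suc r) (k - r) = subst_iter \<phi> n (r + 1)"
  using subst_iter_add_high[of "k - r" r "Suc n"] subst_iter_Suc_last[of n] k r by simp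

lemma W_decomposition:
  assumes "n \<ge> k"
  shows "W n = concat (map (\<lambda>i. W (n - i)) [1..<k - r]) @ subst_iter \<phi> (n - k) (r + 1)"
proof -
  \<comment> \<open>It takes \<open>s\<close> steps from letter 1 to \<open>k - r\<close>; the
    remaining exponent has room for the \<open>Suc r\<close> steps back to
    \<open>r + 1\<close>.\<close>
  define s where "s = k - r - 1"
  have s: "k - r = Suc s" "n - s = n - k + Suc r" "s \<le> n" using assms k by (auto simp: s_def)
  show ?thesis
    using subst_iter_low[of s n 1] subst_iter_wrap[of "n - k"] by (simp add: s del: upt_Suc)
qed

lemma subst_iter_decomposition:
  assumes "n \<ge> k"
  shows "subst_iter \<phi> n (r + 1) =
    concat (map (\<lambda>i. W (n - i)) [1..<k - 2 * r]) @ subst_iter \<phi> (n - k + r) (r + 1)"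
proof -
  \<comment> \<open>From \<open>r + 1\<close> the letter \<open>k - r\<close> is reached after
    \<open>k - 2 * r - 1\<close> steps.\<close>
  have "n - (k - 2 * r - 1) = n - k + r + Suc r" using assms k by simp
  then show ?thesis
    using subst_iter_low[of "k - 2 * r - 1" n "r + 1"] subst_iter_wrap[of "n - k + r"] assms k r
    by (simp add: Suc_diff_Suc)
qed

subsection \<open>Concatenations\<close>

lemma last_subst: "last (\<phi> a) = (if a < k then Suc a else Suc r)"
  using k r by (auto simp: lf_subst_def)

lemma last_subst_word_ne_1:
  assumes "set w \<subseteq> {1..k}" "w \<noteq> []"
  shows "last (subst_word \<phi> w) \<noteq> 1"
  using assms r by (induction w rule: rev_induct) (auto simp: last_subst)

text \<open>Only the letters \<open>r\<close> and \<open>k\<close> have images with a common last letter, and they are told apart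
  by the letter before it, because no image ends with 1.\<close>

lemma suffix_subst_word_cancel:
  assumes "suffix (subst_word \<phi> u) (subst_word \<phi> w)"
    and "set u \<subseteq> {1..k}" "set w \<subseteq> {1..k}" "u \<noteq> [] \<longrightarrow> hd u = 1"
  shows "suffix u w"
  using assms
proof (induction u arbitrary: w rule: rev_induct)
  case (snoc a u)
  have "w \<noteq> []" using snoc.prems(1) by (auto simp: suffix_bot.extremum_uniqueI)
  then obtain v b where w: "w = v @ [b]" by (metis rev_exhaust)
  have ab: "a \<in> {1..k}" "b \<in> {1..k}" using snoc.prems w by auto
  obtain z where z: "subst_word \<phi> v @ \<phi> b = z @ subst_word \<phi> u @ \<phi> a"
    using snoc.prems(1) by (auto simp: w suffix_def)
  have "last (\<phi> a) = last (\<phi> b)" using arg_cong[OF z, of last] by simp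
  then consider "a = b" | "a = r" "b = k" | "a = k" "b = r"
    using ab by (auto simp: last_subst split: if_splits)
  then show ?case
  proof cases
    case 1
    then have "suffix (subst_word \<phi> u) (subst_word \<phi> v)" using z by (auto simp: suffix_def)
    moreover have "u \<noteq> [] \<longrightarrow> hd u = 1" using snoc.prems(4) by (cases u) auto
    ultimately have "suffix u v" using snoc.IH snoc.prems(2,3) w by simp
    then show ?thesis using w 1 by (auto simp: suffix_def)
  next
    case 2
    \<comment> \<open>The images are \<open>[1, r + 1]\<close> for \<open>r\<close> and
      \<open>[r + 1]\<close> for \<open>k\<close>; cancelling the common last letter exposes a
      1.\<close>
    then have v: "subst_word \<phi> v = z @ subst_word \<phi> u @ [1]"
      using z k subst_low[of r] by (simp add: subst_last)
    then have "v \<noteq> []" by auto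
    moreover have "last (subst_word \<phi> v) = 1" by (simp add: v)
    ultimately have False using last_subst_word_ne_1[of v] snoc.prems(3) w by simp
    then show ?thesis ..
  next
    case 3
    \<comment> \<open>Here the condition on the first letter enters: the image of \<open>k\<close>
      is a suffix of the image of \<open>r\<close>, although \<open>[k]\<close> is not a suffix of
      \<open>[r]\<close>.\<close>
    have "k \<noteq> 1" using k r by simp
    then have "u \<noteq> []" using snoc.prems(4) 3 by auto
    moreover have "subst_word \<phi> v @ [1] = z @ subst_word \<phi> u"
      using z 3 k subst_low[of r] by (simp add: subst_last)
    ultimately have "last (subst_word \<phi> u) = 1"
      by (metis last_appendR last_snoc subst_word_eq_Nil_iff)
    then have False using last_subst_word_ne_1[of u] \<open>u \<noteq> []\<close> snoc.prems(2) by simp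
    then show ?thesis ..
  qed
qed simp

lemma W_not_suffix_W: "j < n \<Longrightarrow> \<not> suffix (W j) (W n)"
proof (induction j arbitrary: n)
  case 0
  then obtain m where n: "n = Suc m" by (cases n) auto
  have "last (W n) \<noteq> 1"
    using last_subst_word_ne_1[of "W m"] set_subst_iter_subset[of 1 m] k by (simp add: n subst_iter_Suc)
  then show ?case by (auto simp: suffix_def)
next
  case (Suc j)
  then obtain m where n: "n = Suc m" "j < m" by (cases n) auto
  then show ?case
    using Suc.IH[of m] suffix_subst_word_cancel[of "W j" "W m"] hd_W[of j]
      set_subst_iter_subset[of 1 j] set_subst_iter_subset[of 1 m] k by (auto simp: subst_iter_Suc)
qed

lemma W_not_concat:
  assumes "\<forall>j\<in>set js. j < n"
  shows "W n \<noteq> concat (map W js)"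
proof
  assume eq: "W n = concat (map W js)"
  then have "js \<noteq> []" by auto
  then obtain js' j where "js = js' @ [j]" by (metis rev_exhaust)
  then show False using eq assms W_not_suffix_W[of j n] by (auto simp: suffix_def)
qed

subsection \<open>Fixed and periodic points\<close>

text \<open>Indices from \<open>r\<close> on stand for the letters from \<open>r + 1\<close> on,
  whose images contain no letter up to \<open>r\<close>. The resulting zero block survives in every
  power.\<close>

lemma not_primitive: "k = 2 * r + 1 \<Longrightarrow> \<not> primitive_subst k \<phi>"
proof
  assume k': "k = 2 * r + 1" and "primitive_subst k \<phi>"
  let ?M = "subst_matrix k \<phi>"
  have M: "?M \<in> carrier_mat k k" by (simp add: subst_matrix_def)
  have zero: "(?M ^\<^sub>m m) $$ (i, j) = 0" if "i < r" "r \<le> j" "j < k" for m i j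
    using that
  proof (induction m arbitrary: j)
    case 0
    then show ?case using M by simp
  next
    case (Suc m)
    have "?M $$ (l, j) = 0" if "l < r" for l
      using that Suc.prems k' by (auto simp: subst_matrix_def lf_subst_def)
    moreover have "(?M ^\<^sub>m m) $$ (i, l) = 0" if "r \<le> l" "l < k" for l
      using Suc that by simp
    ultimately have "(\<Sum>l = 0..<k. (?M ^\<^sub>m m) $$ (i, l) * ?M $$ (l, j)) = 0"
      by (intro sum.neutral) (metis atLeastLessThan_iff mult_eq_0_iff not_le)
    moreover have "(?M ^\<^sub>m Suc m) $$ (i, j) = (\<Sum>l = 0..<k. (?M ^\<^sub>m m) $$ (i, l) * ?M $$ (l, j))"
      using M Suc.prems pow_mat_dim_square[OF M, of m] \<open>i < r\<close>
      by (simp add: scalar_prod_def)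
    ultimately show ?case by simp
  qed
  obtain m where "\<forall>i<k. \<forall>j<k. (?M ^\<^sub>m m) $$ (i, j) > 0"
    using \<open>primitive_subst k \<phi>\<close> unfolding primitive_subst_def by blast
  moreover have "0 < k" "r < k" "0 < r" using k' r by auto
  ultimately have "(?M ^\<^sub>m m) $$ (0, r) > 0" by blast
  moreover have "(?M ^\<^sub>m m) $$ (0, r) = 0" using \<open>r < k\<close> \<open>0 < r\<close> by (intro zero) auto
  ultimately show False by simp
qed

text \<open>Under the first-letter map, letters below \<open>k - r\<close> go to 1, which stays; the
  others climb to \<open>k\<close>, then drop to \<open>r + 1\<close>. The bound holds for all large
  \<open>M\<close> so that a multiple of any period can be chosen.\<close>

lemma hd_orbit_reaches_1:
  assumes "2 * r + 1 < k" "a \<in> {1..k}"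
  shows "\<exists>N. \<forall>M\<ge>N. ((\<lambda>b. hd (\<phi> b)) ^^ M) a = 1"
proof -
  let ?h = "\<lambda>b. hd (\<phi> b)"
  have h1: "?h b = 1" if "b < k - r" for b using that by (simp add: lf_subst_def)
  have stay: "\<forall>M\<ge>N. (?h ^^ M) b = 1" if "(?h ^^ N) b = 1" for N b
  proof (intro allI impI)
    fix M assume "N \<le> M"
    then show "(?h ^^ M) b = 1"
      using that by (induction rule: dec_induct) (use h1[of 1] k r in auto)
  qed
  have "\<exists>N. (?h ^^ N) a = 1" using assms(2)
  proof (induction "k - a" arbitrary: a)
    case 0
    \<comment> \<open>Here \<open>a = k\<close>, and \<open>r + 1 < k - r\<close> by the strict
      inequality.\<close>
    then have "(?h ^^ 2) a = 1"
      using h1[of "r + 1"] assms(1) by (simp add: numeral_2_eq_2 subst_last)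
    then show ?case ..
  next
    case (Suc d)
    show ?case
    proof (cases "a < k - r")
      case True
      then have "(?h ^^ 1) a = 1" by (simp add: h1)
      then show ?thesis ..
    next
      case False
      then have "?h a = Suc a" using Suc.hyps(2) k by (auto simp: lf_subst_def)
      moreover have "d = k - Suc a" "Suc a \<in> {1..k}" using Suc.hyps(2) Suc.prems by auto
      then obtain N where "(?h ^^ N) (Suc a) = 1" using Suc.hyps(1)[of "Suc a"] by blast
      ultimately have "(?h ^^ Suc N) a = 1" by (simp add: funpow_Suc_right del: funpow.simps)
      then show ?thesis ..
    qed
  qed
  then show ?thesis using stay by blast
qed

lemma fixed_and_periodic_points:
  assumes "primitive_subst k \<phi>"
  shows "\<exists>v. fixed_points {1..k} \<phi> = {v} \<and> periodic_points {1..k} \<phi> = {v}"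
proof -
  have k': "2 * r + 1 < k" using not_primitive assms k by fastforce
  obtain v where v: "v \<in> fixed_points {1..k} \<phi>" "shd v = 1"
    by (rule fixed_stream_exists[of \<phi> 1 "{1..k}"]) (use set_subst length_W k W_Suc in auto)
  have "u = v" if periodic: "u \<in> periodic_points {1..k} \<phi>" for u
  proof -
    obtain m where m: "m \<ge> 1" "(subst_stream \<phi> ^^ m) u = u" and u: "u \<in> streams {1..k}"
      using periodic unfolding periodic_points_def by blast
    obtain N where N: "\<forall>M\<ge>N. ((\<lambda>b. hd (\<phi> b)) ^^ M) (shd u) = 1"
      using hd_orbit_reaches_1[OF k' streams_shd[OF u]] by blast
    have "shd u = ((\<lambda>b. hd (\<phi> b)) ^^ (m * N)) (shd u)"
      using funpow_mult_fixed[OF m(2), of N] shd_funpow_subst_stream[where n = "m * N" and v = u] by metis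
    then have "shd u = 1" using N m(1) by simp
    moreover have "(subst_stream \<phi> ^^ 1) v = v" using v by (simp add: fixed_points_def)
    ultimately show ?thesis
      using periodic_stream_unique[OF subst_nonempty length_W, of u m v 1] m v(2) by simp
  qed
  then show ?thesis using v(1) fixed_points_subset_periodic_points[of "{1..k}" \<phi>] by blast
qed

subsection \<open>The characteristic polynomial\<close>

lemma char_poly_subst_matrix: "char_poly (subst_matrix k \<phi>) = lf_poly k r"
proof -
  define n where "n = k - 1"
  define s where "s = k - r - 1"
  have n: "k = Suc n" and s: "r \<le> s" "s + r = n" "0 < s" using k r by (auto simp: n_def s_def)
  define X :: "int poly" where "X = monom 1 1"
  \<comment> \<open>The 0-based index of the last letter of the image of letter
    \<open>j + 1\<close>.\<close>
  define \<sigma> where "\<sigma> j = (if j < n then Suc j else r)" for j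
  define A where "A = char_poly_matrix (subst_matrix k \<phi>)"
  \<comment> \<open>The solution of \<open>f 0 = 1\<close> and
    \<open>f (Suc j) = f j * X - (if j < s then 1 else 0)\<close>, which is what makes columns
    \<open>j < n\<close> cancel. The truncation of \<open>i - s\<close> to 0 handles the range
    \<open>i \<le> s\<close>.\<close>
  define f :: "nat \<Rightarrow> int poly" where "f i = monom 1 i - (\<Sum>t=i - s..<i. monom 1 t)" for i
  have M: "subst_matrix k \<phi> \<in> carrier_mat k k" by (simp add: subst_matrix_def)
  have A: "A \<in> carrier_mat (Suc n) (Suc n)" using M n by (simp add: A_def)
  have entryM: "subst_matrix k \<phi> $$ (i, j)
      = (if i = 0 \<and> j < s then 1 else 0) + (if i = \<sigma> j then 1 else 0)" if "i \<le> n" "j \<le> n" for i j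
    using that n s r by (auto simp: subst_matrix_def lf_subst_def \<sigma>_def)
  have entry: "A $$ (i, j) = (if i = j then X else 0) - (if i = 0 then (if j < s then 1 else 0) else 0)
      - (if i = \<sigma> j then 1 else 0)" if "i \<le> n" "j \<le> n" for i j
  proof -
    have "A $$ (i, j) = (if i = j then X else 0) - [:subst_matrix k \<phi> $$ (i, j):]"
      using that n M by (auto simp: A_def char_poly_matrix_def X_def monom_Suc one_pCons)
    then show ?thesis unfolding entryM[OF that] by (auto simp: one_pCons)
  qed
  have row: "(\<Sum>i\<le>n. f i * A $$ (i, j)) = f j * X - f 0 * (if j < s then 1 else 0) - f (\<sigma> j)"
    if "j \<le> n" for j
  proof -
    have "\<sigma> j \<le> n" using that s by (auto simp: \<sigma>_def)
    have "(\<Sum>i\<le>n. f i * A $$ (i, j)) = (\<Sum>i\<le>n. (if i = j then f i * X else 0)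
        - (if i = 0 then f i * (if j < s then 1 else 0) else 0) - (if i = \<sigma> j then f i else 0))"
      using that by (intro sum.cong) (auto simp: entry algebra_simps)
    then show ?thesis using that \<open>\<sigma> j \<le> n\<close> by (simp add: sum_subtractf)
  qed
  have f_X: "f j * X = monom 1 (Suc j) - (\<Sum>t=Suc (j - s)..<Suc j. monom 1 t)" for j
    by (simp only: f_def X_def left_diff_distrib sum_distrib_right mult_monom sum.shift_bounds_Suc_ivl) simp
  have f_0: "f 0 = 1" by (simp add: f_def)
  have f_Suc: "f j * X - f 0 * (if j < s then 1 else 0) - f (Suc j) = 0" for j
  proof (cases "j < s")
    case True
    then have "f (Suc j) = monom 1 (Suc j) - (\<Sum>t=0..<Suc j. monom 1 t)" by (simp add: f_def)
    also have "(\<Sum>t=0..<Suc j. monom 1 t :: int poly) = 1 + (\<Sum>t=Suc 0..<Suc j. monom 1 t)"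
      by (subst sum.atLeast_Suc_lessThan) auto
    finally show ?thesis using True by (simp add: f_X f_0)
  next
    case False
    then show ?thesis unfolding f_X by (simp add: f_def Suc_diff_le)
  qed
  have "det A = (\<Sum>i\<le>n. f i * A $$ (i, n))"
  proof (rule det_hessenberg[OF A])
    fix i j assume "Suc j < i" "i \<le> n"
    then show "A $$ (i, j) = 0" by (auto simp: entry \<sigma>_def)
  next
    fix j assume "j < n"
    then show "A $$ (Suc j, j) = -1" by (auto simp: entry \<sigma>_def)
  next
    fix j assume "j < n"
    then show "(\<Sum>i\<le>n. f i * A $$ (i, j)) = 0" using row[of j] f_Suc[of j] by (simp add: \<sigma>_def)
  qed (rule f_0)
  also have "\<dots> = f n * X - f r" using row[of n] s by (simp add: \<sigma>_def)
  also have "\<dots> = monom 1 k - (\<Sum>t=Suc r..<k. monom 1 t) - (monom 1 r - (\<Sum>t=0..<r. monom 1 t))"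
  proof -
    \<comment> \<open>Since \<open>r \<le> s\<close>, the sum in \<open>f r\<close> starts at 0 and
      supplies the positive low-order terms of \<open>lf_poly\<close>.\<close>
    have "n - s = r" "r - s = 0" using s by auto
    then show ?thesis unfolding f_X by (simp add: f_def n)
  qed
  also have "\<dots> = lf_poly k r"
  proof -
    have "(\<Sum>t=r..<k. monom 1 t :: int poly) = monom 1 r + (\<Sum>t=Suc r..<k. monom 1 t)"
      using k by (intro sum.atLeast_Suc_lessThan) simp
    then show ?thesis by (simp add: lf_poly_def atLeast0LessThan)
  qed
  finally show ?thesis by (simp add: A_def char_poly_def)
qed

subsection \<open>Lengths\<close>

lemma length_concat_W:
  "int (length (concat (map (\<lambda>t. W (n + t)) (rev [0..<i])))) = (\<Sum>t<i. int (length (W (n + t))))"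
  by (induction i) auto

lemma length_subst_iter_low:
  assumes "j + i \<le> k - r"
  shows "int (length (subst_iter \<phi> (n + i) j))
    = (\<Sum>t<i. int (length (W (n + t)))) + int (length (subst_iter \<phi> n (j + i)))"
  using subst_iter_add_low[OF assms, of n] length_concat_W[of n i] by simp

lemma length_W_low:
  assumes "n < k - r"
  shows "int (length (W n)) = 2 ^ n"
  using assms
proof (induction n rule: less_induct)
  case (less n)
  have "int (length (W n)) = (\<Sum>t<n. int (length (W t))) + 1"
    using length_subst_iter_low[of 1 n 0] less.prems by simp
  also have "(\<Sum>t<n. int (length (W t))) = (\<Sum>t<n. 2 ^ t)"
    using less by (intro sum.cong) auto
  also have "\<dots> + 1 = (2 :: int) ^ n" by (induction n) auto
  finally show ?case .
qed

text \<open>After \<open>k - r - 1\<close> steps the last letter is \<open>k - r\<close>. The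
  remaining \<open>m \<le> r\<close> steps only raise it, without reaching the wrap at
  \<open>k\<close>, so it contributes length 1.\<close>

lemma length_W_middle_sum:
  assumes "m \<le> r"
  shows "int (length (W (m + (k - r - 1)))) = (\<Sum>t<k - r - 1. int (length (W (m + t)))) + 1"
proof -
  have "subst_iter \<phi> m (k - r) = [k - r + m]"
    using subst_iter_add_high[of "k - r" m 0] assms k by simp
  moreover have "1 + (k - r - 1) = k - r" using k by simp
  ultimately show ?thesis using length_subst_iter_low[of 1 "k - r - 1" m] by simp
qed

lemma length_W_middle:
  assumes "m \<le> r"
  shows "int (length (W (m + (k - r - 1)))) = 2 ^ (m + (k - r - 1)) - int m * 2 ^ (m - 1)"
  using assms
proof (induction m)
  case 0
  then show ?case using length_W_low[of "k - r - 1"] k r by simp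
next
  case (Suc m)
  let ?a = "\<lambda>n. int (length (W n))"
  define s where "s = k - r - 1"
  have s: "s = Suc (s - 1)" "m < s" using k r Suc.prems by (auto simp: s_def)
  \<comment> \<open>The sums for \<open>m\<close> and \<open>Suc m\<close> are overlapping windows,
    so subtracting them leaves a three-term recurrence.\<close>
  have "(\<Sum>t<s. ?a (Suc m + t)) + ?a m = (\<Sum>t<Suc s. ?a (m + t))"
    by (subst sum.lessThan_Suc_shift) simp
  then have "?a (Suc m + s) = 2 * ?a (m + s) - ?a m"
    using length_W_middle_sum[of m] length_W_middle_sum[of "Suc m"] Suc.prems by (simp add: s_def)
  also have "?a m = 2 ^ m" using length_W_low[of m] s by (simp add: s_def)
  also have "?a (m + s) = 2 ^ (m + s) - int m * 2 ^ (m - 1)" using Suc by (simp add: s_def)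
  \<comment> \<open>For \<open>m = 0\<close> the exponent \<open>m - 1\<close> truncates, but its
    factor \<open>int m\<close> vanishes.\<close>
  finally show ?case unfolding s_def[symmetric] by (cases m) (auto simp: algebra_simps)
qed

text \<open>Unfolding from letter 1 to the wrap, and from letter 1 only to \<open>r + 1\<close>,
  leaves the same remainder of length \<open>?b\<close>. Eliminating it produces the term
  \<open>j = r\<close> and the negative terms.\<close>

lemma length_W_recurrence:
  "int (length (W (n + k))) = (\<Sum>j=r..<k. int (length (W (n + j)))) - (\<Sum>j<r. int (length (W (n + j))))"
proof -
  let ?a = "\<lambda>n. int (length (W n))" and ?b = "int (length (subst_iter \<phi> n (r + 1)))"
  have "n + Suc r + (k - r - 1) = n + k" and "1 + (k - r - 1) = k - r" using k by auto
  then have "?a (n + k) = (\<Sum>t<k - r - 1. ?a (n + Suc r + t)) + ?b"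
    using length_subst_iter_low[of 1 "k - r - 1" "n + Suc r"] subst_iter_wrap[of n] by simp
  also have "(\<Sum>t<k - r - 1. ?a (n + Suc r + t)) = (\<Sum>j=Suc r..<k. ?a (n + j))"
    by (rule sum.reindex_bij_witness[of _ "\<lambda>j. j - Suc r" "\<lambda>t. t + Suc r"]) (auto simp: ac_simps)
  also have "(\<Sum>j=r..<k. ?a (n + j)) = ?a (n + r) + (\<Sum>j=Suc r..<k. ?a (n + j))"
    using k by (intro sum.atLeast_Suc_lessThan) simp
  moreover have "?a (n + r) = (\<Sum>t<r. ?a (n + t)) + ?b"
    using length_subst_iter_low[of 1 r n] k by simp
  ultimately show ?thesis by simp
qed

lemma lorenz_fib_eq_length: "lorenz_fib k r n = int (length (W n))"
proof (induction n rule: less_induct)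
  case (less n)
  consider "n < k - r" | "k - r \<le> n" "n < k" | "k \<le> n" by linarith
  then show ?case
  proof cases
    case 1
    then show ?thesis using lorenz_fib_initial(1)[of r k n] length_W_low[of n] by simp
  next
    case 2
    \<comment> \<open>In this range \<open>m\<close> is at least 1 and equals the linear factor in
      the initial values.\<close>
    define m where "m = n - (k - r - 1)"
    have m: "n = m + (k - r - 1)" "m \<le> r" "n - (k - r) = m - 1" "int n - int k + int r + 1 = int m"
      using 2 k by (auto simp: m_def)
    have "lorenz_fib k r n = 2 ^ n - int m * 2 ^ (m - 1)"
      using lorenz_fib_initial(2)[of r k n] 2 k m(3,4) by simp
    then show ?thesis using length_W_middle[OF m(2)] m(1) by simp
  next
    case 3
    then obtain l where n: "n = l + k" by (metis add.commute le_Suc_ex)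
    have "lorenz_fib k r n = (\<Sum>j=r..<k. lorenz_fib k r (l + j)) - (\<Sum>j<r. lorenz_fib k r (l + j))"
      unfolding n using k by (intro lorenz_fib_recurrence) simp
    also have "\<dots> = int (length (W n))"
      unfolding n length_W_recurrence using less k by (simp add: n)
    finally show ?thesis .
  qed
qed

end

theorem theorem8:
  fixes k r :: nat
  assumes "2 * r + 1 \<le> k" and "1 \<le> r"
  defines "\<phi> \<equiv> lf_subst k r"
  shows
    "(primitive_subst k \<phi> \<longrightarrow>
        (\<exists>v. fixed_points {1..k} \<phi> = {v} \<and> periodic_points {1..k} \<phi> = {v}))
     \<and> (\<forall>n>k.
          subst_iter \<phi> n 1 =
            concat (map (\<lambda>i. subst_iter \<phi> (n - i) 1) [1..<k - r]) @ subst_iter \<phi> (n - k) (r + 1)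
        \<and> subst_iter \<phi> n (r + 1) =
            concat (map (\<lambda>i. subst_iter \<phi> (n - i) 1) [1..<k - 2 * r])
              @ subst_iter \<phi> (n - k + r) (r + 1)
        \<and> \<not> (\<exists>js. (\<forall>j\<in>set js. j \<le> n - 1) \<and>
              subst_iter \<phi> n 1 = concat (map (\<lambda>j. subst_iter \<phi> j 1) js)))
     \<and> char_poly (subst_matrix k \<phi>) = lf_poly k r
     \<and> (\<forall>n. lorenz_fib k r n = int (length (subst_iter \<phi> n 1)))"
proof -
  interpret lorenz_fib_substitution k r by unfold_locales fact+
  have "subst_iter \<phi> n 1 \<noteq> concat (map (\<lambda>j. subst_iter \<phi> j 1) js)"
    if "n > k" "\<forall>j\<in>set js. j \<le> n - 1" for n js
  proof -
    have "\<forall>j\<in>set js. j < n" using that by auto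
    then show ?thesis using W_not_concat[of js n] unfolding \<phi>_def One_nat_def by blast
  qed
  then have not_concat: "\<not> (\<exists>js. (\<forall>j\<in>set js. j \<le> n - 1) \<and>
      subst_iter \<phi> n 1 = concat (map (\<lambda>j. subst_iter \<phi> j 1) js))" if "n > k" for n
    using that by blast
  then show ?thesis
    using fixed_and_periodic_points char_poly_subst_matrix
      W_decomposition[folded One_nat_def, OF less_imp_le]
      subst_iter_decomposition[folded One_nat_def, OF less_imp_le]
      lorenz_fib_eq_length[folded One_nat_def]
    unfolding \<phi>_def by fast
qed

end
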